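(* Let $p,q,s$ be integers with $|p|,|q|\geq 2$ and $s\geq 0$. Let $A\in M_2(\mathbb{Z})$ have characteristic polynomial $f(x)=x^2-(p+q)x+pq$, and let $\mathcal{D}=\{0,1,\dots,|pq|-2,\ |pq|-1+s\}v$ (that is, $\mathcal{D}=\{kv: k=0,1,\dots,|pq|-2\}\cup\{(|pq|-1+s)v\}$), where $v\in\mathbb{R}^2$ is such that $\{v,Av\}$ is linearly independent. Then: (i) if $f(x)$ is none of the polynomials $x^2+4x+4$, $x^2-4x+4$, $x^2+7x+12$, $x^2-7x+12$, then $T(A,\mathcal{D})$ is connected if and only if $s=0$; (ii) if $f(x)$ is one of the polynomials $x^2+4x+4$, $x^2-4x+4$, $x^2+7x+12$, $x^2-7x+12$, then $T(A,\mathcal{D})$ is connected if and only if $s=0$ or $s=1$.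
   Context: A matrix $A\in M_n(\mathbb{Z})$ is expanding if all its (complex) eigenvalues have moduli strictly greater than $1$. For an expanding $A\in M_n(\mathbb{Z})$ and a finite set $\mathcal{D}\subset\mathbb{R}^n$ (a digit set), the self-affine set $T(A,\mathcal{D})$ is the unique non-empty compact set $T\subset\mathbb{R}^n$ satisfying $T=\bigcup_{d\in\mathcal{D}}A^{-1}(T+d)$; equivalently $T=\left\{\sum_{i=1}^\infty A^{-i}d_{j_i}: d_{j_i}\in\mathcal{D}\right\}$. (Here the eigenvalues of $A$ are $p$ and $q$, so $A$ is expanding.) *)

theory Defs
  imports "HOL-Analysis.Analysis" "HOL-Computational_Algebra.Polynomial"
begin

(* det (x I - A), computed over the polynomial ring. *)
definition charpoly :: "'a::comm_ring_1 ^ 'n ^ 'n \<Rightarrow> 'a poly" where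
  "charpoly A = det (mat [:0, 1:] - map_matrix (\<lambda>a. [:a:]) A)"

definition real_matrix :: "int ^ 'n ^ 'm \<Rightarrow> real ^ 'n ^ 'm" where
  "real_matrix A = map_matrix of_int A"

(* The description is proper (the set exists and is unique) when A is expanding and
   D is finite and non-empty; otherwise the value may be unspecified. *)
definition self_affine_set :: "int ^ 'n ^ 'n \<Rightarrow> (real ^ 'n) set \<Rightarrow> (real ^ 'n) set" where
  "self_affine_set A D =
     (THE T. T \<noteq> {} \<and> compact T \<and>
        T = (\<Union>d\<in>D. (\<lambda>x. matrix_inv (real_matrix A) *v (x + d)) ` T))"

definition digit_set :: "int \<Rightarrow> int \<Rightarrow> int \<Rightarrow> real ^ 'n \<Rightarrow> (real ^ 'n) set" where
  "digit_set p q s v =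
     (\<lambda>k. of_int k *\<^sub>R v) ` ({0..\<bar>p * q\<bar> - 2} \<union> {\<bar>p * q\<bar> - 1 + s})"

end

theory Submission
  imports Defs
begin

text \<open>The pieces of \<open>T\<close> belonging to digits \<open>d\<close> and \<open>d'\<close> meet iff \<open>d - d' \<in> T - T\<close>, and \<open>T - T\<close> is
  itself the attractor for the digit differences. If the digits can be chained through such
  meetings, then \<open>T\<close> is \<open>\<epsilon>\<close>-chained for every \<open>\<epsilon>\<close>, hence connected. A vector lies in \<open>T - T\<close>
  as soon as its orbit under \<open>x \<mapsto> A x - b\<close>, for suitable digit differences \<open>b\<close>, stays bounded,
  and finite orbits starting at \<open>v\<close> and, in the exceptional cases, at \<open>2 v\<close> give connectedness.

  Conversely, if \<open>T\<close> is connected, the piece of the last digit meets another one, so \<open>m v \<in> T - T\<close>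
  for some \<open>m \<ge> s + 1\<close>. With \<open>l = \<bar>p q\<bar> - 1 + s\<close> the largest digit difference, the linear form
  \<open>\<beta>\<close> with \<open>\<beta> v = 0\<close> and \<open>\<beta> (A v) = 1\<close> satisfies \<open>\<bar>\<beta>\<bar> \<le> l / ((\<bar>p\<bar> - 1) (\<bar>q\<bar> - 1))\<close> on \<open>T - T\<close>.
  The first two steps of the orbit of \<open>m v\<close> have \<open>\<beta>\<close>-values \<open>m\<close> and \<open>(p + q) m - b\<close> with
  \<open>\<bar>b\<bar> \<le> l\<close>. For \<open>p\<close> and \<open>q\<close> of equal sign these bounds leave only the exceptional polynomials
  with \<open>s = 1\<close>; for opposite signs the bound \<open>\<bar>\<beta>\<bar> (\<bar>p q\<bar> - 1 - \<bar>p + q\<bar>) \<le> l\<close> leaves nothing.\<close>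

section \<open>Attractors of affine systems with a common linear part\<close>

definition attractor :: "('a::real_normed_vector \<Rightarrow> 'a) \<Rightarrow> 'a set \<Rightarrow> 'a set \<Rightarrow> bool" where
  "attractor M D T \<longleftrightarrow> T \<noteq> {} \<and> compact T \<and> T = (\<Union>d\<in>D. (\<lambda>x. M (x + d)) ` T)"

definition difference_set :: "'a::group_add set \<Rightarrow> 'a set" where
  "difference_set X = {x - y | x y. x \<in> X \<and> y \<in> X}"

lemma difference_set_minus: "k \<in> difference_set E \<Longrightarrow> - k \<in> difference_set E"
  for k :: "'a::ab_group_add"
  unfolding difference_set_def by force

text \<open>A separation would split \<open>T\<close> into two disjoint compact sets, which lie at a
  positive distance \<open>e\<close>; a chain with steps shorter than \<open>e\<close> cannot cross
  from one to the other.\<close>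

lemma connected_if_chains:
  fixes T :: "'a::euclidean_space set"
  assumes "compact T"
    and chain: "\<And>e x y. \<lbrakk>e > 0; x \<in> T; y \<in> T\<rbrakk> \<Longrightarrow>
      (x, y) \<in> {(x, y). x \<in> T \<and> y \<in> T \<and> dist x y < e}\<^sup>*"
  shows "connected T"
proof (rule ccontr)
  assume "\<not> connected T"
  then obtain X Y where XY: "closedin (top_of_set T) X" "closedin (top_of_set T) Y"
    "X \<union> Y = T" "X \<inter> Y = {}" "X \<noteq> {}" "Y \<noteq> {}"
    unfolding connected_closedin_eq by blast
  then have "compact X" "compact Y"
    using \<open>compact T\<close> closedin_compact by blast+
  then obtain e where e: "e > 0" "\<And>x y. x \<in> X \<Longrightarrow> y \<in> Y \<Longrightarrow> e \<le> dist x y"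
    using separate_compact_closed[of X Y] XY(4) compact_imp_closed by blast
  obtain x y where "x \<in> X" "y \<in> Y" using XY by blast
  then have "(x, y) \<in> {(x, y). x \<in> T \<and> y \<in> T \<and> dist x y < e}\<^sup>*"
    using chain[OF e(1)] XY(3) by blast
  then have "y \<in> X"
  proof (induction rule: rtrancl_induct)
    case (step y z)
    then show ?case using e(2)[of y z] XY(3) by fastforce
  qed (use \<open>x \<in> X\<close> in auto)
  with \<open>y \<in> Y\<close> XY(4) show False by blast
qed

text \<open>\<open>N\<close> plays the role of a norm adapted to \<open>M\<close>: with respect to the ambient norm only
  a power of \<open>M\<close> need be a contraction.\<close>

locale expanding_map =
  fixes A M :: "'a::euclidean_space \<Rightarrow> 'a" and N :: "'a \<Rightarrow> real" and c :: real
  assumes linA: "linear A" and linM: "linear M"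
    and AM [simp]: "A (M x) = x" and MA [simp]: "M (A x) = x"
    and norm_le_N: "norm x \<le> N x"
    and N_add: "N (x + y) \<le> N x + N y"
    and N_cont: "continuous_on UNIV N"
    and N_contr: "N (M x) \<le> c * N x"
    and c: "0 \<le> c" "c < 1"
begin

lemma N_nonneg: "0 \<le> N x"
  using norm_le_N[of x] norm_ge_zero[of x] by linarith

lemma N_0: "N 0 = 0"
proof -
  have "N 0 \<le> c * N 0" using N_contr[of 0] linear_0[OF linM] by simp
  then have "(1 - c) * N 0 \<le> 0" by (simp add: algebra_simps)
  then have "N 0 \<le> 0" using c by (simp add: mult_le_0_iff)
  then show ?thesis using N_nonneg[of 0] by simp
qed

lemma N_bounded:
  assumes "bounded X"
  obtains C where "\<And>x. x \<in> X \<Longrightarrow> N x \<le> C"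
proof -
  have "compact (N ` closure X)"
    using assms N_cont continuous_on_subset by (intro compact_continuous_image) auto
  then obtain C where "\<And>x. x \<in> closure X \<Longrightarrow> \<bar>N x\<bar> \<le> C"
    using compact_imp_bounded bounded_real by fastforce
  then show thesis using that[of C] closure_subset[of X] by fastforce
qed

lemma cont_piece: "continuous_on X (\<lambda>x. M (x + d))"
  by (rule linear_continuous_on_compose[OF _ linM]) (intro continuous_intros)

section \<open>Attractors: orbits, coinduction, uniqueness, existence\<close>

lemma attractor_mem_iff:
  assumes "attractor M D T"
  shows "x \<in> T \<longleftrightarrow> (\<exists>d\<in>D. A x - d \<in> T)"
proof -
  have "x \<in> T \<longleftrightarrow> x \<in> (\<Union>d\<in>D. (\<lambda>x. M (x + d)) ` T)"
    using assms unfolding attractor_def by blast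
  also have "\<dots> \<longleftrightarrow> (\<exists>d\<in>D. A x - d \<in> T)"
  proof safe
    fix d y assume "d \<in> D" "y \<in> T"
    then show "\<exists>e\<in>D. A (M (y + d)) - e \<in> T" by (intro bexI[of _ d]) auto
  next
    fix d assume "d \<in> D" "A x - d \<in> T"
    then show "x \<in> (\<Union>d\<in>D. (\<lambda>x. M (x + d)) ` T)"
      by (intro UN_I[of d] image_eqI[of _ _ "A x - d"]) auto
  qed
  finally show ?thesis .
qed

lemma attractorI:
  assumes "T \<noteq> {}" "compact T" "\<And>x. x \<in> T \<longleftrightarrow> (\<exists>d\<in>D. A x - d \<in> T)"
  shows "attractor M D T"
  unfolding attractor_def
proof (intro conjI set_eqI iffI)
  fix x assume "x \<in> T"
  then obtain d where "d \<in> D" "A x - d \<in> T" using assms(3) by blast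
  then show "x \<in> (\<Union>d\<in>D. (\<lambda>x. M (x + d)) ` T)"
    by (intro UN_I[of d] image_eqI[of _ _ "A x - d"]) auto
next
  fix x assume "x \<in> (\<Union>d\<in>D. (\<lambda>x. M (x + d)) ` T)"
  then obtain d y where "d \<in> D" "y \<in> T" "x = M (y + d)" by blast
  then have "A x - d \<in> T" by simp
  with \<open>d \<in> D\<close> show "x \<in> T" using assms(3) by blast
qed (use assms in auto)

lemma attractor_piece:
  assumes "attractor M D T" "x \<in> T" "d \<in> D"
  shows "M (x + d) \<in> T"
  using assms unfolding attractor_def by blast

text \<open>Follow an orbit inside \<open>Z\<close> for \<open>n\<close> steps, replace its end by a
  fixed point \<open>t\<close> of \<open>T\<close> and pull back along the same digits. The result
  lies in \<open>T\<close>, and the error shrinks to \<open>c ^ n * C\<close>; \<open>T\<close> is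
  closed.\<close>

lemma attractor_coinduct:
  assumes T: "attractor M D T" and "bounded Z"
    and Z: "\<And>z. z \<in> Z \<Longrightarrow> \<exists>d\<in>D. A z - d \<in> Z"
  shows "Z \<subseteq> T"
proof
  fix z assume "z \<in> Z"
  have cT: "compact T" "T \<noteq> {}" using T unfolding attractor_def by auto
  then obtain t where "t \<in> T" by blast
  have "bounded ((\<lambda>z. z - t) ` Z)" using \<open>bounded Z\<close> by (rule bounded_translation_minus)
  then obtain C where C: "\<And>z. z \<in> Z \<Longrightarrow> N (z - t) \<le> C"
    using N_bounded by (metis imageI)
  have approx: "\<exists>y\<in>T. N (z - y) \<le> c ^ n * C" if "z \<in> Z" for n z
    using that
  proof (induction n arbitrary: z)
    case 0
    then show ?case using C \<open>t \<in> T\<close> by (intro bexI[of _ t]) auto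
  next
    case (Suc n)
    then obtain d where d: "d \<in> D" "A z - d \<in> Z" using Z by blast
    then obtain y where y: "y \<in> T" "N (A z - d - y) \<le> c ^ n * C" using Suc.IH by blast
    have "z - M (y + d) = M (A z - d - y)"
      using linear_diff[OF linM] linear_add[OF linM] by simp
    then have "N (z - M (y + d)) \<le> c * N (A z - d - y)" using N_contr by metis
    also have "\<dots> \<le> c ^ Suc n * C" using y(2) c(1) mult_left_mono by fastforce
    finally show ?case
      using attractor_piece[OF T y(1) d(1)] by blast
  qed
  have lim: "(\<lambda>n. c ^ n * C) \<longlonglongrightarrow> 0"
    using c by (auto intro!: tendsto_eq_intros LIMSEQ_realpow_zero)
  have "\<exists>y\<in>T. dist y z < e" if "e > 0" for e
  proof -
    obtain n where "c ^ n * C < e"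
      using eventually_happens[OF order_tendstoD(2)[OF lim \<open>e > 0\<close>]] by auto
    moreover obtain y where "y \<in> T" "N (z - y) \<le> c ^ n * C" using approx[OF \<open>z \<in> Z\<close>] by blast
    ultimately show ?thesis
      using norm_le_N[of "z - y"] by (auto simp: dist_norm norm_minus_commute intro!: bexI[of _ y])
  qed
  then have "z \<in> closure T" by (simp add: closure_approachable)
  then show "z \<in> T" using closure_closed[OF compact_imp_closed[OF cT(1)]] by simp
qed

lemma attractor_unique:
  assumes "attractor M D T" "attractor M D T'"
  shows "T = T'"
proof -
  have "S \<subseteq> S'" if S: "attractor M D S" and S': "attractor M D S'" for S S'
  proof (rule attractor_coinduct[OF S'])
    show "bounded S" using S compact_imp_bounded unfolding attractor_def by blast
  qed (use attractor_mem_iff[OF S] in blast)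
  then show ?thesis using assms by blast
qed

text \<open>The map \<open>F\<close> sends a large \<open>N\<close>-ball into itself, so its
  iterates \<open>K n\<close> are nested non-empty compact sets. Their intersection is the
  attractor.\<close>

lemma attractor_exists:
  assumes "finite D" "D \<noteq> {}"
  shows "\<exists>T. attractor M D T"
proof -
  define m where "m = Max (N ` D)"
  have m: "N d \<le> m" if "d \<in> D" for d using that assms by (simp add: m_def)
  have "0 \<le> m" using assms(2) m N_nonneg order_trans by blast
  \<comment> \<open>The radius solves \<open>c * (R + m) = R\<close>, which is what makes the ball
    invariant.\<close>
  define R where "R = c * m / (1 - c)"
  have R: "c * (R + m) = R" using c by (simp add: R_def field_simps)
  have "0 \<le> R" using c \<open>0 \<le> m\<close> by (simp add: R_def)
  define F where "F X = (\<Union>d\<in>D. (\<lambda>x. M (x + d)) ` X)" for X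
  define K where "K n = (F ^^ n) {x. N x \<le> R}" for n
  have K_Suc: "K (Suc n) = F (K n)" for n by (simp add: K_def)
  have F_iff: "x \<in> F X \<longleftrightarrow> (\<exists>d\<in>D. A x - d \<in> X)" for x X
  proof safe
    assume "x \<in> F X"
    then obtain d y where "d \<in> D" "y \<in> X" "x = M (y + d)" unfolding F_def by blast
    then show "\<exists>d\<in>D. A x - d \<in> X" by (intro bexI[of _ d]) auto
  next
    fix d assume "d \<in> D" "A x - d \<in> X"
    then show "x \<in> F X" unfolding F_def
      by (intro UN_I[of d] image_eqI[of _ _ "A x - d"]) auto
  qed
  have K_compact: "compact (K n)" for n
  proof (induction n)
    case 0
    have "closed {x. N x \<le> R}"
      using N_cont by (intro closed_Collect_le) auto
    moreover have "bounded {x. N x \<le> R}"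
      using norm_le_N order_trans by (intro boundedI[of _ R]) blast
    ultimately show ?case by (simp add: K_def compact_eq_bounded_closed)
  next
    case (Suc n)
    then show ?case unfolding K_Suc F_def
      using assms cont_piece by (intro compact_UN compact_continuous_image) auto
  qed
  have K_dec: "K (Suc n) \<subseteq> K n" for n
  proof (induction n)
    case 0
    have "N x \<le> R" if "d \<in> D" "N (A x - d) \<le> R" for x d
    proof -
      have "N x \<le> c * N (A x - d + d)" using N_contr[of "A x"] by simp
      also have "\<dots> \<le> c * (R + m)"
        using N_add[of "A x - d" d] that m[of d] c(1) by (intro mult_left_mono) auto
      finally show ?thesis using R by simp
    qed
    then show ?case by (auto simp: K_Suc F_iff) (auto simp: K_def)
  next
    case (Suc n)
    then show ?case by (subst (1 2) K_Suc) (auto simp: F_def)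
  qed
  have K_ne: "K n \<noteq> {}" for n
  proof (induction n)
    case 0
    then show ?case using N_0 \<open>0 \<le> R\<close> by (auto simp: K_def intro: exI[of _ 0])
  qed (use assms in \<open>auto simp: K_Suc F_def\<close>)
  have K_antimono: "K n \<subseteq> K k" if "k \<le> n" for k n
    using that K_dec by (rule lift_Suc_antimono_le[rotated])
  define T where "T = (\<Inter>n. K n)"
  have "T \<noteq> {}" unfolding T_def
    using K_compact K_ne K_antimono by (intro compact_nest) auto
  moreover have "compact T" unfolding T_def
    using K_compact by (intro compact_Inter) auto
  moreover have "x \<in> T \<longleftrightarrow> (\<exists>d\<in>D. A x - d \<in> T)" for x
  proof
    assume "x \<in> T"
    then have *: "\<exists>d\<in>D. A x - d \<in> K n" for n
      using K_Suc[of n] F_iff unfolding T_def by blast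
    show "\<exists>d\<in>D. A x - d \<in> T"
    \<comment> \<open>The digit found for \<open>K n\<close> may depend on \<open>n\<close>. As
      \<open>D\<close> is finite, a single level lies beyond the failure levels of all digits, and
      the digit found there gives the contradiction.\<close>
    proof (rule ccontr)
      assume "\<not> ?thesis"
      then have "\<forall>d\<in>D. \<exists>n. A x - d \<notin> K n" unfolding T_def by blast
      then obtain k where k: "\<And>d. d \<in> D \<Longrightarrow> A x - d \<notin> K (k d)" by metis
      obtain d where d: "d \<in> D" "A x - d \<in> K (Max (k ` D))" using * by blast
      then have "A x - d \<in> K (k d)" using K_antimono[of "k d" "Max (k ` D)"] assms by auto
      then show False using k d by blast
    qed
  next
    assume "\<exists>d\<in>D. A x - d \<in> T"
    then have "x \<in> K (Suc n)" for n unfolding T_def K_Suc F_iff by blast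
    then show "x \<in> T" using K_dec unfolding T_def by blast
  qed
  ultimately show ?thesis using attractorI by blast
qed

section \<open>Difference sets and criteria for connectedness\<close>

lemma attractor_difference_set:
  assumes T: "attractor M D T"
  shows "attractor M (difference_set D) (difference_set T)"
proof (rule attractorI)
  show "difference_set T \<noteq> {}" "compact (difference_set T)"
    using T compact_differences[of T T] unfolding attractor_def difference_set_def by auto
  fix x
  show "x \<in> difference_set T \<longleftrightarrow> (\<exists>b\<in>difference_set D. A x - b \<in> difference_set T)"
  proof
    assume "x \<in> difference_set T"
    then obtain t t' where t: "t \<in> T" "t' \<in> T" "x = t - t'" unfolding difference_set_def by blast
    then obtain d d' where d: "d \<in> D" "d' \<in> D" "A t - d \<in> T" "A t' - d' \<in> T"
      using attractor_mem_iff[OF T] by metis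
    have "A x - (d - d') = (A t - d) - (A t' - d')"
      using t(3) linear_diff[OF linA] by simp
    then show "\<exists>b\<in>difference_set D. A x - b \<in> difference_set T" using d unfolding difference_set_def by blast
  next
    assume "\<exists>b\<in>difference_set D. A x - b \<in> difference_set T"
    then obtain d d' t t' where d: "d \<in> D" "d' \<in> D" "t \<in> T" "t' \<in> T" "A x - (d - d') = t - t'"
      unfolding difference_set_def by blast
    then have "M (t + d) \<in> T" "M (t' + d') \<in> T"
      using attractor_piece[OF T] by blast+
    moreover have "x = M (t + d) - M (t' + d')"
    proof -
      have "A x = (t + d) - (t' + d')" using d(5) by (simp add: algebra_simps)
      then show ?thesis using MA[of x] linear_diff[OF linM] by metis
    qed
    ultimately show "x \<in> difference_set T" unfolding difference_set_def by blast
  qed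
qed

text \<open>By induction on \<open>n\<close>, any two points of \<open>T\<close> are joined by steps
  of \<open>N\<close>-size at most \<open>c ^ n * C\<close>: a piece map shrinks chains by the
  factor \<open>c\<close>, and pieces of linked digits share a point where such chains can be
  joined.\<close>

lemma attractor_connected:
  assumes T: "attractor M D T"
    and chain: "\<And>d d'. d \<in> D \<Longrightarrow> d' \<in> D \<Longrightarrow>
      (d, d') \<in> {(d, d'). d \<in> D \<and> d' \<in> D \<and> d' - d \<in> difference_set T}\<^sup>*"
  shows "connected T"
proof -
  have cT: "compact T" using T unfolding attractor_def by blast
  have "bounded (difference_set T)"
    using attractor_difference_set[OF T] compact_imp_bounded unfolding attractor_def by blast
  then obtain C where C: "\<And>x. x \<in> difference_set T \<Longrightarrow> N x \<le> C"
    using N_bounded by blast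
  define E where "E n = {(x, y). x \<in> T \<and> y \<in> T \<and> N (x - y) \<le> c ^ n * C}" for n
  have E: "(x, y) \<in> (E n)\<^sup>*" if "x \<in> T" "y \<in> T" for x y n
    using that
  proof (induction n arbitrary: x y)
    case 0
    then show ?case using C unfolding E_def difference_set_def by auto
  next
    case (Suc n)
    have same: "(M (x + d), M (y + d)) \<in> (E (Suc n))\<^sup>*"
      if "d \<in> D" "(x, y) \<in> (E n)\<^sup>*" for d x y
      using that(2)
    proof (induction rule: rtrancl_induct)
      case (step y z)
      have "N (M (y + d) - M (z + d)) = N (M (y - z))"
        using linear_diff[OF linM] by (metis add_diff_cancel_right)
      also have "\<dots> \<le> c * N (y - z)" by (rule N_contr)
      also have "\<dots> \<le> c ^ Suc n * C"
        using step(2) c(1) mult_left_mono by (fastforce simp: E_def)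
      finally have "(M (y + d), M (z + d)) \<in> E (Suc n)"
        using step(2) attractor_piece[OF T _ that(1)] by (auto simp: E_def)
      with step.IH show ?case by (rule rtrancl_into_rtrancl)
    qed auto
    have "(M (x + d), M (y + d')) \<in> (E (Suc n))\<^sup>*"
      if "d \<in> D" "d' \<in> D" "x \<in> T" "y \<in> T" for d d' x y
      using chain[OF that(1,2)] that(4)
    proof (induction arbitrary: y rule: rtrancl_induct)
      case base
      then show ?case using same[OF that(1)] Suc.IH[OF that(3)] by blast
    next
      case (step d1 d2)
      then obtain t t' where t: "t \<in> T" "t' \<in> T" "d2 - d1 = t - t'" "d2 \<in> D"
        unfolding difference_set_def by auto
      \<comment> \<open>Hence \<open>M (t + d1)\<close> lies in the pieces of both \<open>d1\<close>
        and \<open>d2\<close>.\<close>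
      then have eq: "t + d1 = t' + d2" by (simp add: algebra_simps)
      have "(M (x + d), M (t + d1)) \<in> (E (Suc n))\<^sup>*" using step.IH t(1) by blast
      also have "(M (t + d1), M (y + d2)) \<in> (E (Suc n))\<^sup>*"
        unfolding eq using same[OF t(4)] Suc.IH[OF t(2) step.prems] by blast
      finally show ?case .
    qed
    moreover obtain d d' where "d \<in> D" "d' \<in> D" "A x - d \<in> T" "A y - d' \<in> T"
      using Suc.prems attractor_mem_iff[OF T] by metis
    ultimately show ?case by (metis MA diff_add_cancel)
  qed
  show ?thesis
  proof (rule connected_if_chains[OF cT])
    fix e :: real and x y assume "e > 0" "x \<in> T" "y \<in> T"
    have "(\<lambda>n. c ^ n * C) \<longlonglongrightarrow> 0"
      using c by (auto intro!: tendsto_eq_intros LIMSEQ_realpow_zero)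
    then obtain n where n: "c ^ n * C < e"
      using eventually_happens[OF order_tendstoD(2)[OF _ \<open>e > 0\<close>]] by force
    have "dist x y < e" if "N (x - y) \<le> c ^ n * C" for x y
      using norm_le_N[of "x - y"] n that by (simp add: dist_norm)
    then have "E n \<subseteq> {(x, y). x \<in> T \<and> y \<in> T \<and> dist x y < e}" by (auto simp: E_def)
    then show "(x, y) \<in> {(x, y). x \<in> T \<and> y \<in> T \<and> dist x y < e}\<^sup>*"
      using E[OF \<open>x \<in> T\<close> \<open>y \<in> T\<close>] rtrancl_mono by blast
  qed
qed

text \<open>The piece of \<open>d\<close> and the union of all other pieces are then disjoint
  non-empty compact sets covering \<open>T\<close>.\<close>

lemma attractor_disconnected:
  assumes T: "attractor M D T" and "finite D" "d \<in> D" "D \<noteq> {d}"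
    and sep: "\<And>d'. d' \<in> D \<Longrightarrow> d' \<noteq> d \<Longrightarrow> d - d' \<notin> difference_set T"
  shows "\<not> connected T"
proof -
  define X where "X = (\<lambda>x. M (x + d)) ` T"
  define Y where "Y = (\<Union>d'\<in>D - {d}. (\<lambda>x. M (x + d')) ` T)"
  have cT: "compact T" "T \<noteq> {}" and Teq: "T = (\<Union>d\<in>D. (\<lambda>x. M (x + d)) ` T)"
    using T unfolding attractor_def by auto
  have "compact X" "compact Y" unfolding X_def Y_def
    using cT assms cont_piece by (auto intro!: compact_UN compact_continuous_image)
  moreover have "X \<union> Y = T" unfolding X_def Y_def using Teq \<open>d \<in> D\<close> by blast
  moreover have "X \<noteq> {}" "Y \<noteq> {}" unfolding X_def Y_def using cT(2) assms by auto
  moreover have "X \<inter> Y = {}"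
  proof (rule ccontr)
    assume "X \<inter> Y \<noteq> {}"
    then obtain t t' d' where t: "t \<in> T" "t' \<in> T" "d' \<in> D" "d' \<noteq> d" "M (t + d) = M (t' + d')"
      unfolding X_def Y_def by auto
    then have "t + d = t' + d'" using AM by metis
    then have "d - d' = t' - t" by (simp add: algebra_simps)
    then show False using sep[of d'] t unfolding difference_set_def by blast
  qed
  ultimately show ?thesis
    unfolding connected_closed using compact_imp_closed by blast
qed

end

section \<open>Integer inequalities\<close>

text \<open>Here \<open>a\<close> and \<open>b\<close> stand for the absolute values of
  \<open>p\<close> and \<open>q\<close> minus one. The last two hypotheses are the first two bounds
  of \<open>multiple_bounds\<close> at \<open>m = s + 1\<close>.\<close>

lemma same_sign_bounds:
  fixes a b s :: int
  assumes a: "a \<ge> 1" and b: "b \<ge> 1" and s: "s \<ge> 1"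
    and 1: "(s + 1) * (a * b) \<le> a * b + a + b + s"
    and 2: "((a + b + 2) * (s + 1) - (a * b + a + b + s)) * (a * b) \<le> a * b + a + b + s"
  shows "s = 1 \<and> (a = 1 \<and> b = 1 \<or> a = 2 \<and> b = 3 \<or> a = 3 \<and> b = 2)"
proof -
  define S where "S = a + b"
  define K where "K = a * b"
  have "K \<ge> 1" using mult_mono[of 1 a 1 b] a b by (simp add: K_def)
  have "S \<ge> 2" using a b by (simp add: S_def)
  have "s * (K - 1) \<le> S" using 1 by (simp add: S_def K_def algebra_simps)
  moreover have "K - 1 \<le> s * (K - 1)"
    using mult_right_mono[of 1 s "K - 1"] s \<open>K \<ge> 1\<close> by simp
  ultimately have KS: "K - 1 \<le> S" by simp
  \<comment> \<open>Both products are nonnegative, the second one because of \<open>KS\<close>, so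
    both vanish.\<close>
  have sum: "(s - 1) * (S * K + K - 1) + (K - 1) * (S - K + 1) \<le> 0"
    using 2 by (simp add: S_def K_def algebra_simps)
  have "S * K \<ge> 2" using mult_mono[of 2 S 1 K] \<open>S \<ge> 2\<close> \<open>K \<ge> 1\<close> by simp
  then have pos: "S * K + K - 1 > 0" using \<open>K \<ge> 1\<close> by simp
  have nn: "0 \<le> (s - 1) * (S * K + K - 1)" "0 \<le> (K - 1) * (S - K + 1)"
    using s pos KS \<open>K \<ge> 1\<close> by simp_all
  then have "(s - 1) * (S * K + K - 1) = 0" "(K - 1) * (S - K + 1) = 0" using sum by linarith+
  then have "s = 1" and K: "K = 1 \<or> K = S + 1" using pos by auto
  from K have "a = 1 \<and> b = 1 \<or> a = 2 \<and> b = 3 \<or> a = 3 \<and> b = 2"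
  proof
    assume "K = 1"
    then show ?thesis using a b by (simp add: K_def zmult_eq_1_iff)
  next
    assume "K = S + 1"
    then have ab: "(a - 1) * (b - 1) = 2" by (simp add: K_def S_def algebra_simps)
    then have "a - 1 \<noteq> 0" by auto
    then have "1 \<le> a - 1" using a by linarith
    moreover have "a - 1 \<le> 2" using zdvd_imp_le[of "a - 1" 2] ab by (metis dvd_triv_left zero_less_numeral)
    ultimately have "a = 2 \<or> a = 3" by linarith
    then show ?thesis using ab by auto
  qed
  with \<open>s = 1\<close> show ?thesis by blast
qed

lemma opposite_sign_bound:
  fixes P Q s :: int
  assumes "P \<ge> 2" "Q \<ge> 2" "s \<ge> 1"
  shows "P * Q - 1 + s < (s + 1) * (P * Q - 1 - \<bar>P - Q\<bar>)"
proof -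
  have *: "P * Q - 1 + s < (s + 1) * (P * Q - 1 - (Q - P))" if "2 \<le> P" "P \<le> Q" for P Q
  proof -
    \<comment> \<open>This settles the case \<open>s = 1\<close> of the rearranged claim
      \<open>Q - P < s * (P * Q + P - Q - 2)\<close>; the factor of \<open>s\<close> is positive, so
      larger \<open>s\<close> only helps.\<close>
    have "0 \<le> (P - 2) * (Q + 2)" using that by simp
    then have gt: "Q - P < P * Q + P - Q - 2" by (simp add: algebra_simps)
    also have "\<dots> \<le> s * (P * Q + P - Q - 2)"
      using mult_right_mono[of 1 s "P * Q + P - Q - 2"] that gt \<open>s \<ge> 1\<close> by simp
    finally show ?thesis by (simp add: algebra_simps)
  qed
  show ?thesis
    using *[of P Q] *[of Q P] assms by (cases "P \<le> Q") (auto simp: mult.commute)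
qed

lemma multiple_bounds_exceptional:
  fixes p q s m :: int
  assumes p: "\<bar>p\<bar> \<ge> 2" and q: "\<bar>q\<bar> \<ge> 2" and s: "s \<ge> 1" and m: "m \<ge> s + 1"
    and 1: "m * ((\<bar>p\<bar> - 1) * (\<bar>q\<bar> - 1)) \<le> \<bar>p * q\<bar> - 1 + s"
    and 2: "(\<bar>p + q\<bar> * m - (\<bar>p * q\<bar> - 1 + s)) * ((\<bar>p\<bar> - 1) * (\<bar>q\<bar> - 1)) \<le> \<bar>p * q\<bar> - 1 + s"
    and 3: "m * (\<bar>p * q\<bar> - 1 - \<bar>p + q\<bar>) \<le> \<bar>p * q\<bar> - 1 + s"
  shows "s = 1 \<and> (p * q = 4 \<and> \<bar>p + q\<bar> = 4 \<or> p * q = 12 \<and> \<bar>p + q\<bar> = 7)"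
proof (cases "p > 0 \<longleftrightarrow> q > 0")
  case True
  define a where "a = \<bar>p\<bar> - 1"
  define b where "b = \<bar>q\<bar> - 1"
  have ab: "a \<ge> 1" "b \<ge> 1" using p q by (simp_all add: a_def b_def)
  have pq: "p * q = (a + 1) * (b + 1)" "\<bar>p + q\<bar> = a + b + 2" "\<bar>p * q\<bar> = (a + 1) * (b + 1)"
    using True p q unfolding a_def b_def by (auto simp only: abs_mult) (auto simp: abs_if)
  have l: "\<bar>p * q\<bar> - 1 + s = a * b + a + b + s" unfolding pq(3) by (simp add: algebra_simps)
  have K: "0 \<le> a * b" using ab by simp
  have "(s + 1) * (a * b) \<le> m * (a * b)" using m K by (rule mult_right_mono)
  also have "\<dots> \<le> a * b + a + b + s" using 1 unfolding l by (simp add: a_def b_def)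
  finally have 1: "(s + 1) * (a * b) \<le> a * b + a + b + s" .
  have "(a + b + 2) * (s + 1) \<le> (a + b + 2) * m" using m ab by (intro mult_left_mono) auto
  then have "((a + b + 2) * (s + 1) - (a * b + a + b + s)) * (a * b)
      \<le> ((a + b + 2) * m - (a * b + a + b + s)) * (a * b)"
    using K by (intro mult_right_mono) auto
  also have "\<dots> \<le> a * b + a + b + s"
    using 2 unfolding l pq(2) by (simp add: a_def b_def)
  finally show ?thesis using same_sign_bounds[OF ab s 1] unfolding pq(1,2) by auto
next
  case False
  define P where "P = \<bar>p\<bar>"
  define Q where "Q = \<bar>q\<bar>"
  have PQ: "\<bar>p * q\<bar> = P * Q" "\<bar>p + q\<bar> = \<bar>P - Q\<bar>" "P \<ge> 2" "Q \<ge> 2"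
    using False p q unfolding P_def Q_def by (auto simp: abs_mult)
  note lt = opposite_sign_bound[OF PQ(3,4) s]
  have "0 < P * Q - 1 + s" using mult_mono[of 2 P 2 Q] PQ s by simp
  \<comment> \<open>Positivity is needed to replace \<open>m\<close> by \<open>s + 1\<close> in the
    third bound.\<close>
  then have "0 < P * Q - 1 - \<bar>P - Q\<bar>"
    using lt s mult_nonneg_nonpos[of "s + 1" "P * Q - 1 - \<bar>P - Q\<bar>"] by linarith
  then have "(s + 1) * (P * Q - 1 - \<bar>P - Q\<bar>) \<le> m * (P * Q - 1 - \<bar>P - Q\<bar>)"
    using m by (intro mult_right_mono) auto
  then show ?thesis using 3 lt unfolding PQ(1,2) by linarith
qed

text \<open>\<open>e\<close> is the sign of whichever of \<open>p\<close> and \<open>q\<close> is smaller in absolute value.\<close>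

lemma small_digits:
  fixes p q :: int
  assumes "\<bar>p\<bar> \<ge> 2" "\<bar>q\<bar> \<ge> 2"
  obtains e :: int where "e = 1 \<or> e = -1"
    "\<bar>p + q - e\<bar> \<le> \<bar>p * q\<bar> - 1" "\<bar>(p - e) * (q - e)\<bar> \<le> \<bar>p * q\<bar> - 1"
proof -
  have *: "\<bar>p + q - sgn p\<bar> \<le> \<bar>p * q\<bar> - 1 \<and> \<bar>(p - sgn p) * (q - sgn p)\<bar> \<le> \<bar>p * q\<bar> - 1"
    if pq: "2 \<le> \<bar>p\<bar>" "\<bar>p\<bar> \<le> \<bar>q\<bar>" for p q :: int
  proof
    have "0 \<le> (\<bar>p\<bar> - 2) * (\<bar>q\<bar> - 2)" using pq by simp
    then have "\<bar>p\<bar> + \<bar>q\<bar> \<le> \<bar>p * q\<bar>" using pq by (simp add: abs_mult algebra_simps)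
    moreover have p1: "\<bar>p - sgn p\<bar> = \<bar>p\<bar> - 1" using pq by (auto simp: sgn_if)
    ultimately show "\<bar>p + q - sgn p\<bar> \<le> \<bar>p * q\<bar> - 1" by linarith
    \<comment> \<open>The first factor shrinks by one and the second grows by at most one. As
      \<open>p\<close> is the smaller in absolute value, the product stays below that of
      \<open>p\<close> and \<open>q\<close>.\<close>
    have "\<bar>q - sgn p\<bar> \<le> \<bar>q\<bar> + 1" by (auto simp: sgn_if)
    then have "\<bar>p - sgn p\<bar> * \<bar>q - sgn p\<bar> \<le> (\<bar>p\<bar> - 1) * (\<bar>q\<bar> + 1)"
      unfolding p1 using pq by (intro mult_left_mono) auto
    then show "\<bar>(p - sgn p) * (q - sgn p)\<bar> \<le> \<bar>p * q\<bar> - 1"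
      using pq unfolding abs_mult[of "p - sgn p"] by (simp add: abs_mult algebra_simps)
  qed
  have "sgn r = 1 \<or> sgn r = -1" if "2 \<le> \<bar>r\<bar>" for r :: int using that by (auto simp: sgn_if)
  then show thesis
    using that[of "sgn p"] that[of "sgn q"] *[of p q] *[of q p] assms
    by (cases "\<bar>p\<bar> \<le> \<bar>q\<bar>") (auto simp: mult.commute add.commute)
qed

section \<open>Linear maps with an expanding quadratic characteristic polynomial\<close>

text \<open>\<open>M\<close> is annihilated by \<open>(x - 1/p) (x - 1/q)\<close>, so it maps
  \<open>z = M x - x/p\<close> to \<open>z/q\<close>. Since \<open>norm (M x)\<close> is at most
  \<open>norm x / 2 + norm z\<close>, the weight 4 on \<open>z\<close> yields the factor
  \<open>3 / 4\<close>, also when \<open>p = q\<close>.\<close>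

lemma expanding_map_quadratic:
  fixes A M :: "'a::euclidean_space \<Rightarrow> 'a" and p q :: real
  assumes "linear A" "linear M" "\<And>x. A (M x) = x" "\<And>x. M (A x) = x"
    and quad: "\<And>x. A (A x) = (p + q) *\<^sub>R A x - (p * q) *\<^sub>R x"
    and p: "\<bar>p\<bar> \<ge> 2" and q: "\<bar>q\<bar> \<ge> 2"
  shows "expanding_map A M (\<lambda>x. norm x + 4 * norm (M x - (1 / p) *\<^sub>R x)) (3 / 4)"
proof (rule expanding_map.intro)
  note lin = linear_add[OF \<open>linear M\<close>] linear_diff[OF \<open>linear M\<close>] linear_scale[OF \<open>linear M\<close>]
  have "p \<noteq> 0" "q \<noteq> 0" using p q by auto
  have le_half: "norm ((1 / r) *\<^sub>R x) \<le> norm x / 2" if "\<bar>r\<bar> \<ge> 2" for r and x :: 'a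
    using that mult_right_mono[OF that norm_ge_zero[of x]] by (simp add: field_simps)
  fix x y :: 'a
  show "norm (x + y) + 4 * norm (M (x + y) - (1 / p) *\<^sub>R (x + y))
      \<le> norm x + 4 * norm (M x - (1 / p) *\<^sub>R x) + (norm y + 4 * norm (M y - (1 / p) *\<^sub>R y))"
    using norm_triangle_ineq[of x y] norm_triangle_ineq[of "M x - (1 / p) *\<^sub>R x" "M y - (1 / p) *\<^sub>R y"]
    by (simp add: lin algebra_simps)
  show "continuous_on UNIV (\<lambda>x. norm x + 4 * norm (M x - (1 / p) *\<^sub>R x))"
    using linear_continuous_on[OF linear_conv_bounded_linear[THEN iffD1, OF \<open>linear M\<close>]]
    by (intro continuous_intros)
  define z where "z = M x - (1 / p) *\<^sub>R x"
  have "M x = (1 / p) *\<^sub>R x + z" by (simp add: z_def)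
  then have 1: "norm (M x) \<le> norm x / 2 + norm z"
    using norm_triangle_ineq[of "(1 / p) *\<^sub>R x" z] le_half[OF p, of x]
    by (metis add_le_cancel_right order_trans)
  have x: "x = (p + q) *\<^sub>R M x - (p * q) *\<^sub>R M (M x)"
    using quad[of "M (M x)"] assms(3) by simp
  have inv_sum: "1 / p + 1 / q = (p + q) / (p * q)"
    using \<open>p \<noteq> 0\<close> \<open>q \<noteq> 0\<close> by (simp add: field_simps)
  from x have "(1 / (p * q)) *\<^sub>R x = (1 / (p * q)) *\<^sub>R ((p + q) *\<^sub>R M x - (p * q) *\<^sub>R M (M x))"
    by simp
  also have "\<dots> = (1 / p + 1 / q) *\<^sub>R M x - M (M x)"
    using \<open>p \<noteq> 0\<close> \<open>q \<noteq> 0\<close> by (simp add: scaleR_diff_right inv_sum)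
  finally have "M (M x) = (1 / p + 1 / q) *\<^sub>R M x - (1 / (p * q)) *\<^sub>R x"
    by (simp add: algebra_simps)
  then have "M (M x) - (1 / p) *\<^sub>R M x = (1 / q) *\<^sub>R z"
    by (simp add: z_def algebra_simps)
  then have "norm (M (M x) - (1 / p) *\<^sub>R M x) \<le> norm z / 2"
    using le_half[OF q, of z] by metis
  then show "norm (M x) + 4 * norm (M (M x) - (1 / p) *\<^sub>R M x)
      \<le> 3 / 4 * (norm x + 4 * norm (M x - (1 / p) *\<^sub>R x))"
    using 1 norm_ge_zero[of x] unfolding z_def[symmetric] by argo
qed (use assms in auto)

locale quadratic_map = expanding_map A M N c
  for A M :: "'a::euclidean_space \<Rightarrow> 'a" and N :: "'a \<Rightarrow> real" and c :: real +
  fixes p q :: int and v :: 'a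
  assumes quad: "A (A x) = of_int (p + q) *\<^sub>R A x - of_int (p * q) *\<^sub>R x"
begin

section \<open>Digits that are integer multiples of \<open>v\<close>\<close>

definition digits :: "int set \<Rightarrow> 'a set" where
  "digits E = (\<lambda>k. of_int k *\<^sub>R v) ` E"

lemma difference_set_digits: "difference_set (digits E) = digits (difference_set E)"
proof (intro set_eqI iffI)
  fix x assume "x \<in> difference_set (digits E)"
  then obtain j k where "j \<in> E" "k \<in> E" "x = of_int j *\<^sub>R v - of_int k *\<^sub>R v"
    unfolding digits_def difference_set_def by blast
  then show "x \<in> digits (difference_set E)"
    unfolding digits_def difference_set_def
    by (intro image_eqI[of _ _ "j - k"]) (auto simp: scaleR_left_diff_distrib)
next
  fix x assume "x \<in> digits (difference_set E)"
  then obtain j k where "j \<in> E" "k \<in> E" "x = of_int (j - k) *\<^sub>R v"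
    unfolding digits_def difference_set_def by blast
  then have "x = of_int j *\<^sub>R v - of_int k *\<^sub>R v"
    "of_int j *\<^sub>R v \<in> digits E" "of_int k *\<^sub>R v \<in> digits E"
    by (auto simp: digits_def scaleR_left_diff_distrib)
  then show "x \<in> difference_set (digits E)" unfolding difference_set_def by blast
qed

text \<open>A finite set \<open>Z\<close> closed under suitable orbit steps certifies membership in
  T - T, so explicit eventually periodic orbits suffice.\<close>

lemma coinduct_digits:
  assumes "attractor M (digits E) T" "finite Z" "z \<in> Z"
    and "\<And>z. z \<in> Z \<Longrightarrow> \<exists>k\<in>difference_set E. A z - of_int k *\<^sub>R v \<in> Z"
  shows "z \<in> difference_set T"
proof -
  have "Z \<subseteq> difference_set T"
    using assms(4) finite_imp_bounded[OF assms(2)]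
    by (intro attractor_coinduct[OF attractor_difference_set[OF assms(1)]])
      (auto simp: difference_set_digits digits_def[of "difference_set E"])
  then show ?thesis using \<open>z \<in> Z\<close> by blast
qed

text \<open>Dividing \<open>m (x - p) (x - q)\<close> by \<open>x - e\<close> with \<open>e = 1\<close> or \<open>e = -1\<close> gives an expansion of
  \<open>m v\<close> in powers of \<open>A\<inverse>\<close> whose digits are, from the second one on, constant up to sign.\<close>

lemma difference_set_const_digits:
  fixes e m :: int
  assumes T: "attractor M (digits E) T" and e: "e = 1 \<or> e = -1"
    and 1: "m * (p + q - e) \<in> difference_set E"
    and 2: "m * ((p - e) * (q - e)) \<in> difference_set E"
  shows "of_int m *\<^sub>R v \<in> difference_set T"
proof -
  \<comment> \<open>\<open>R\<close> is the first orbit point after \<open>m v\<close>; the next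
    step leads to \<open>R\<close> or \<open>- R\<close>, so the orbit is finite.\<close>
  define R where "R = of_int (m * (e - p - q)) *\<^sub>R v + of_int m *\<^sub>R A v"
  note lin = linear_add[OF linA] linear_diff[OF linA] linear_scale[OF linA] linear_neg[OF linA]
  have R1: "A (of_int m *\<^sub>R v) - of_int (m * (p + q - e)) *\<^sub>R v = R"
    unfolding R_def by (simp add: lin algebra_simps)
  have R2: "A R - of_int (- (m * ((p - e) * (q - e)))) *\<^sub>R v = of_int e *\<^sub>R R"
    using e unfolding R_def by (auto simp: lin quad algebra_simps)
  have R3: "A (- R) - of_int (m * ((p - e) * (q - e))) *\<^sub>R v = of_int (- e) *\<^sub>R R"
    using arg_cong[OF R2, of uminus] by (simp add: lin)
  have Z: "of_int e *\<^sub>R R \<in> {of_int m *\<^sub>R v, R, - R}" "of_int (- e) *\<^sub>R R \<in> {of_int m *\<^sub>R v, R, - R}"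
    using e by auto
  show ?thesis
  proof (rule coinduct_digits[OF T, of "{of_int m *\<^sub>R v, R, - R}"])
    fix z assume "z \<in> {of_int m *\<^sub>R v, R, - R}"
    then consider "z = of_int m *\<^sub>R v" | "z = R" | "z = - R" by blast
    then show "\<exists>k\<in>difference_set E. A z - of_int k *\<^sub>R v \<in> {of_int m *\<^sub>R v, R, - R}"
    proof cases
      case 1
      then show ?thesis using R1 assms(3) by blast
    next
      case 2
      then show ?thesis using R2 Z(1) difference_set_minus[OF assms(4)] by metis
    next
      case 3
      then show ?thesis using R3 Z(2) assms(4) by metis
    qed
  qed auto
qed

text \<open>Expansion obtained from \<open>(x - 2 e)^2 (2 + 4 e x^(-1) + 4 x^(-2) + 4 e x^(-3) + \<dots>)\<close>, whose
  coefficients are \<open>2\<close> and then \<open>\<plusminus> 4\<close>.\<close>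

lemma difference_set_double_root:
  fixes e :: int
  assumes T: "attractor M (digits E) T" and e: "e = 1 \<or> e = -1"
    and pq: "p + q = 4 * e" "p * q = 4" and 4: "4 \<in> difference_set E"
  shows "2 *\<^sub>R v \<in> difference_set T"
proof -
  define R where "R = 2 *\<^sub>R A v - of_int (4 * e) *\<^sub>R v"
  \<comment> \<open>\<open>S\<close> is the second orbit point after \<open>2 v\<close>; from there
    the orbit stays in \<open>S\<close> and \<open>- S\<close>.\<close>
  define S where "S = of_int (4 * e) *\<^sub>R A v - 12 *\<^sub>R v"
  note lin = linear_add[OF linA] linear_diff[OF linA] linear_scale[OF linA] linear_neg[OF linA]
  have quad': "A (A x) = of_int (4 * e) *\<^sub>R A x - 4 *\<^sub>R x" for x
    using quad[of x] unfolding pq by simp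
  have R0: "A (2 *\<^sub>R v) - of_int (4 * e) *\<^sub>R v = R" unfolding R_def by (simp add: lin)
  have R1: "A R - of_int 4 *\<^sub>R v = S"
    using e unfolding R_def S_def by (auto simp: lin quad' algebra_simps simp flip: scaleR_left_distrib)
  have 16: "16 *\<^sub>R x = 4 *\<^sub>R x + 12 *\<^sub>R x" for x :: 'a
    by (simp flip: scaleR_left_distrib)
  have S1: "A S - of_int (- 4 * e) *\<^sub>R v = of_int e *\<^sub>R S"
    using e unfolding S_def by (auto simp: lin quad' algebra_simps 16)
  have S2: "A (- S) - of_int (4 * e) *\<^sub>R v = of_int (- e) *\<^sub>R S"
    using arg_cong[OF S1, of uminus] by (simp add: lin)
  have k: "4 * e \<in> difference_set E" "- 4 * e \<in> difference_set E"
    using e 4 difference_set_minus[OF 4] by auto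
  define Z where "Z = {2 *\<^sub>R v, R, S, - S}"
  have Z: "R \<in> Z" "S \<in> Z" "of_int e *\<^sub>R S \<in> Z" "of_int (- e) *\<^sub>R S \<in> Z"
    using e by (auto simp: Z_def)
  show ?thesis
  proof (rule coinduct_digits[OF T, of Z])
    fix z assume "z \<in> Z"
    then consider "z = 2 *\<^sub>R v" | "z = R" | "z = S" | "z = - S" unfolding Z_def by blast
    then show "\<exists>k\<in>difference_set E. A z - of_int k *\<^sub>R v \<in> Z"
      by cases (metis R0 Z(1) k(1), metis R1 Z(2) 4, metis S1 Z(3) k(2), metis S2 Z(4) k(1))
  qed (auto simp: Z_def)
qed

text \<open>Consecutive digits up to \<open>n\<close> are linked by \<open>v\<close>, and
  \<open>n\<close> is linked to \<open>l\<close>. Links are symmetric, so chains through 0 join all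
  digits.\<close>

lemma connected_if_unit_step:
  assumes T: "attractor M (digits ({0..n} \<union> {l})) T" and "n \<ge> 0"
    and v: "v \<in> difference_set T" and l: "of_int (l - n) *\<^sub>R v \<in> difference_set T"
  shows "connected T"
proof -
  define E where "E = {0..n} \<union> {l}"
  define r where "r = {(d, d'). d \<in> digits E \<and> d' \<in> digits E \<and> d' - d \<in> difference_set T}"
  have "(d', d) \<in> r" if "(d, d') \<in> r" for d d'
    using that difference_set_minus[of "d' - d" T] by (auto simp: r_def)
  then have sym: "sym (r\<^sup>*)" by (intro sym_rtrancl symI)
  have link: "(of_int k *\<^sub>R v, of_int k' *\<^sub>R v) \<in> r"
    if "k \<in> E" "k' \<in> E" "of_int (k' - k) *\<^sub>R v \<in> difference_set T" for k k'
    using that by (auto simp: r_def digits_def scaleR_left_diff_distrib)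
  have chain: "(0, of_int k *\<^sub>R v) \<in> r\<^sup>*" if "0 \<le> k" "k \<le> n" for k
    using that
  proof (induction k rule: int_ge_induct)
    case (step k)
    moreover have "(of_int k *\<^sub>R v, of_int (k + 1) *\<^sub>R v) \<in> r"
      using step v by (intro link) (auto simp: E_def)
    ultimately show ?case by (auto intro: rtrancl_into_rtrancl)
  qed simp
  have "(0, of_int l *\<^sub>R v) \<in> r\<^sup>*"
  proof (rule rtrancl_into_rtrancl)
    show "(0, of_int n *\<^sub>R v) \<in> r\<^sup>*" using chain \<open>n \<ge> 0\<close> by simp
    show "(of_int n *\<^sub>R v, of_int l *\<^sub>R v) \<in> r"
      using link[of n l] l \<open>n \<ge> 0\<close> by (simp add: E_def)
  qed
  then have from_0: "(0, d) \<in> r\<^sup>*" if "d \<in> digits E" for d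
    using that chain by (auto simp: digits_def E_def)
  show ?thesis
  proof (rule attractor_connected[OF T])
    fix d d' assume "d \<in> digits ({0..n} \<union> {l})" "d' \<in> digits ({0..n} \<union> {l})"
    then have "(d, 0) \<in> r\<^sup>*" "(0, d') \<in> r\<^sup>*"
      using from_0 sym unfolding E_def by (blast dest: symD)+
    then show "(d, d') \<in> {(d, d'). d \<in> digits ({0..n} \<union> {l}) \<and> d' \<in> digits ({0..n} \<union> {l})
        \<and> d' - d \<in> difference_set T}\<^sup>*"
      unfolding r_def E_def by (rule rtrancl_trans)
  qed
qed

section \<open>Bounds on multiples of \<open>v\<close> in \<open>S\<close>, which stands for T - T,
  with digit differences \<open>B\<close>\<close>

context
  fixes B :: "int set" and S :: "'a set" and l m :: int and \<beta> :: "'a \<Rightarrow> real"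
  assumes S: "attractor M (digits B) S" and B: "\<And>k. k \<in> B \<Longrightarrow> \<bar>k\<bar> \<le> l"
    and \<beta>: "linear \<beta>" "\<beta> v = 0" "\<beta> (A v) = 1"
    and m: "of_int m *\<^sub>R v \<in> S"
begin

lemma successor:
  assumes "x \<in> S"
  obtains k where "\<bar>k\<bar> \<le> l" "A x - of_int k *\<^sub>R v \<in> S"
  using attractor_mem_iff[OF S, of x] assms B unfolding digits_def by blast

lemma functional_attains_max:
  assumes "linear f"
  shows "\<exists>x\<in>S. \<forall>y\<in>S. \<bar>f y\<bar> \<le> \<bar>f x :: real\<bar>"
proof -
  have "continuous_on S (\<lambda>x. \<bar>f x\<bar>)"
    using linear_continuous_on[OF linear_conv_bounded_linear[THEN iffD1, OF assms]]
    by (intro continuous_intros)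
  moreover have "compact S" "S \<noteq> {}" using S unfolding attractor_def by blast+
  ultimately show ?thesis by (rule continuous_attains_sup[rotated 2])
qed

lemmas lin_\<beta> = linear_diff[OF \<beta>(1)] linear_add[OF \<beta>(1)] linear_scale[OF \<beta>(1)] \<beta>(2,3)

text \<open>\<open>\<beta> \<circ> (A - q)\<close> is a left eigenvector of \<open>A\<close> for the eigenvalue \<open>p\<close>.\<close>

lemma \<beta>_bound:
  assumes p: "\<bar>p\<bar> \<ge> 2" and q: "\<bar>q\<bar> \<ge> 2" and x: "x \<in> S"
  shows "\<bar>\<beta> x\<bar> * of_int ((\<bar>p\<bar> - 1) * (\<bar>q\<bar> - 1)) \<le> of_int l"
proof -
  define P where "P = real_of_int (\<bar>p\<bar> - 1)"
  define Q where "Q = real_of_int (\<bar>q\<bar> - 1)"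
  have PQ: "P \<ge> 1" "Q \<ge> 1" using p q unfolding P_def Q_def by simp_all
  define g where "g x = \<beta> (A x) - of_int q * \<beta> x" for x
  have g: "linear g" unfolding g_def
    using linear_compose[OF linA \<beta>(1)] \<beta>(1)
    by (intro linear_compose_sub) (auto simp: o_def intro: linear_compose_scale_right[of \<beta>, simplified])
  \<comment> \<open>Subtracting \<open>k v\<close> lowers \<open>g\<close> by exactly
    \<open>k\<close>. At a maximum of the absolute value of \<open>g\<close> this gives the bound
    \<open>l / P\<close>.\<close>
  have g_succ: "of_int p * g x = g (A x - of_int k *\<^sub>R v) + of_int k" for x k
    unfolding g_def
    by (simp add: quad lin_\<beta> linear_diff[OF linA] linear_scale[OF linA] algebra_simps)
  obtain y where y: "y \<in> S" "\<And>z. z \<in> S \<Longrightarrow> \<bar>g z\<bar> \<le> \<bar>g y\<bar>"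
    using functional_attains_max[OF g] by blast
  obtain k where k: "\<bar>k\<bar> \<le> l" "A y - of_int k *\<^sub>R v \<in> S" using successor[OF y(1)] .
  have "\<bar>real_of_int k\<bar> \<le> of_int l" using k(1) by linarith
  then have "\<bar>of_int p * g y\<bar> \<le> \<bar>g y\<bar> + of_int l"
    unfolding g_succ[of y k] using y(2)[OF k(2)] by linarith
  then have gy: "\<bar>g y\<bar> * P \<le> of_int l" by (simp add: P_def abs_mult algebra_simps)
  have g_le: "\<bar>g z\<bar> \<le> of_int l / P" if "z \<in> S" for z
  proof -
    have "\<bar>g z\<bar> * P \<le> \<bar>g y\<bar> * P" using y(2)[OF that] PQ by (intro mult_right_mono) auto
    then have "\<bar>g z\<bar> * P \<le> of_int l" using gy by linarith
    then show ?thesis using PQ by (simp add: pos_le_divide_eq)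
  qed
  obtain w where w: "w \<in> S" "\<And>z. z \<in> S \<Longrightarrow> \<bar>\<beta> z\<bar> \<le> \<bar>\<beta> w\<bar>"
    using functional_attains_max[OF \<beta>(1)] by blast
  obtain k where k: "\<bar>k\<bar> \<le> l" "A w - of_int k *\<^sub>R v \<in> S" using successor[OF w(1)] .
  \<comment> \<open>The same argument for \<open>q\<close>, with \<open>g w\<close> in the role of
    the digit, since \<open>\<beta>\<close> does not see multiples of \<open>v\<close>.\<close>
  have "of_int q * \<beta> w = \<beta> (A w - of_int k *\<^sub>R v) - g w" by (simp add: g_def lin_\<beta>)
  then have "\<bar>of_int q * \<beta> w\<bar> \<le> \<bar>\<beta> w\<bar> + of_int l / P"
    using w(2)[OF k(2)] g_le[OF w(1)] by linarith
  then have "\<bar>\<beta> w\<bar> * Q \<le> of_int l / P" by (simp add: Q_def abs_mult algebra_simps)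
  moreover have "\<bar>\<beta> x\<bar> * Q \<le> \<bar>\<beta> w\<bar> * Q" using w(2)[OF x] PQ by (intro mult_right_mono) auto
  ultimately have "\<bar>\<beta> x\<bar> * Q \<le> of_int l / P" by simp
  then have "\<bar>\<beta> x\<bar> * (P * Q) \<le> of_int l" using PQ by (simp add: field_simps)
  then show ?thesis by (simp add: P_def Q_def)
qed

text \<open>As \<open>\<beta> v = 0\<close>, a digit affects \<open>\<beta>\<close> only one step
  later, through \<open>A v\<close>. Hence only the first digit \<open>k\<close> occurs.\<close>

lemma two_successors:
  assumes "x \<in> S"
  obtains k y z where "\<bar>k\<bar> \<le> l" "y \<in> S" "z \<in> S" "\<beta> y = \<beta> (A x)"
    "\<beta> z = of_int (p + q) * \<beta> y - of_int (p * q) * \<beta> x - of_int k"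
proof -
  obtain k where k: "\<bar>k\<bar> \<le> l" "A x - of_int k *\<^sub>R v \<in> S" using successor[OF assms] .
  obtain j where j: "A (A x - of_int k *\<^sub>R v) - of_int j *\<^sub>R v \<in> S" using successor[OF k(2)] .
  show thesis
    by (rule that[OF k(1) k(2) j])
      (simp_all add: lin_\<beta> linear_diff[OF linA] linear_scale[OF linA] quad)
qed

text \<open>The first two bounds are \<open>\<beta>_bound\<close> at the first two orbit points
  after \<open>m v\<close>. The third evaluates the recurrence of \<open>two_successors\<close>
  where the absolute value of \<open>\<beta>\<close> is largest.\<close>

lemma multiple_bounds:
  assumes "\<bar>p\<bar> \<ge> 2" "\<bar>q\<bar> \<ge> 2"
  shows "\<bar>m\<bar> * ((\<bar>p\<bar> - 1) * (\<bar>q\<bar> - 1)) \<le> l"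
    and "(\<bar>p + q\<bar> * \<bar>m\<bar> - l) * ((\<bar>p\<bar> - 1) * (\<bar>q\<bar> - 1)) \<le> l"
    and "\<bar>m\<bar> * (\<bar>p * q\<bar> - 1 - \<bar>p + q\<bar>) \<le> l"
proof -
  obtain k y z where kyz: "\<bar>k\<bar> \<le> l" "y \<in> S" "z \<in> S" "\<beta> y = \<beta> (A (of_int m *\<^sub>R v))"
    "\<beta> z = of_int (p + q) * \<beta> y - of_int (p * q) * \<beta> (of_int m *\<^sub>R v) - of_int k"
    using two_successors[OF m] .
  have y: "\<beta> y = of_int m" and z: "\<beta> z = of_int ((p + q) * m - k)"
    using kyz(4,5) by (simp_all add: lin_\<beta> linear_scale[OF linA])
  define K where "K = (\<bar>p\<bar> - 1) * (\<bar>q\<bar> - 1)"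
  have "K \<ge> 0" using assms by (simp add: K_def)
  have "real_of_int (\<bar>m\<bar> * K) \<le> of_int l"
    using \<beta>_bound[OF assms kyz(2)] by (simp add: y K_def)
  then show "\<bar>m\<bar> * ((\<bar>p\<bar> - 1) * (\<bar>q\<bar> - 1)) \<le> l" by (simp only: of_int_le_iff K_def)
  have "real_of_int (\<bar>(p + q) * m - k\<bar> * K) \<le> of_int l"
    using \<beta>_bound[OF assms kyz(3)] unfolding z K_def by simp
  then have "\<bar>(p + q) * m - k\<bar> * K \<le> l" by (simp only: of_int_le_iff)
  moreover have "\<bar>p + q\<bar> * \<bar>m\<bar> - l \<le> \<bar>(p + q) * m - k\<bar>"
    using kyz(1) by (simp flip: abs_mult)
  ultimately show "(\<bar>p + q\<bar> * \<bar>m\<bar> - l) * ((\<bar>p\<bar> - 1) * (\<bar>q\<bar> - 1)) \<le> l"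
    using mult_right_mono[OF _ \<open>K \<ge> 0\<close>] unfolding K_def by (meson order_trans)
next
  obtain w where w: "w \<in> S" "\<And>z. z \<in> S \<Longrightarrow> \<bar>\<beta> z\<bar> \<le> \<bar>\<beta> w\<bar>"
    using functional_attains_max[OF \<beta>(1)] by blast
  obtain k y z where kyz: "\<bar>k\<bar> \<le> l" "y \<in> S" "z \<in> S" "\<beta> y = \<beta> (A w)"
    "\<beta> z = of_int (p + q) * \<beta> y - of_int (p * q) * \<beta> w - of_int k"
    using two_successors[OF w(1)] .
  define C where "C = real_of_int (\<bar>p * q\<bar> - 1 - \<bar>p + q\<bar>)"
  have "\<bar>real_of_int k\<bar> \<le> of_int l" using kyz(1) by linarith
  moreover have "\<bar>of_int (p + q) * \<beta> y\<bar> \<le> \<bar>of_int (p + q)\<bar> * \<bar>\<beta> w\<bar>"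
    unfolding abs_mult using w(2)[OF kyz(2)] by (intro mult_left_mono) auto
  ultimately have "\<bar>of_int (p * q) * \<beta> w\<bar> \<le> \<bar>of_int (p + q)\<bar> * \<bar>\<beta> w\<bar> + \<bar>\<beta> w\<bar> + of_int l"
    using kyz(5) w(2)[OF kyz(3)] by linarith
  then have C: "\<bar>\<beta> w\<bar> * C \<le> of_int l"
    unfolding abs_mult C_def by (simp add: abs_mult algebra_simps)
  obtain y where "y \<in> S" "\<beta> y = \<beta> (A (of_int m *\<^sub>R v))"
    using two_successors[OF m] .
  then have "\<bar>real_of_int m\<bar> \<le> \<bar>\<beta> w\<bar>"
    using w(2) by (simp add: lin_\<beta> linear_scale[OF linA]) metis
  moreover have "0 \<le> real_of_int l" using kyz(1) by simp
  \<comment> \<open>\<open>C\<close> may be negative; then the left side is at most 0, and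
    \<open>l\<close> is nonnegative.\<close>
  ultimately have "\<bar>real_of_int m\<bar> * C \<le> of_int l"
    using C mult_right_mono[of "\<bar>real_of_int m\<bar>" "\<bar>\<beta> w\<bar>" C]
    by (cases "C \<ge> 0") (auto intro: order_trans[OF mult_nonneg_nonpos])
  then have "real_of_int (\<bar>m\<bar> * (\<bar>p * q\<bar> - 1 - \<bar>p + q\<bar>)) \<le> of_int l"
    unfolding C_def by simp
  then show "\<bar>m\<bar> * (\<bar>p * q\<bar> - 1 - \<bar>p + q\<bar>) \<le> l" by (simp only: of_int_le_iff)
qed

end

section \<open>The two directions of the equivalence\<close>

lemma connected_imp_exceptional:
  fixes s :: int and \<beta> :: "'a \<Rightarrow> real"
  defines "n \<equiv> \<bar>p * q\<bar> - 2"
  assumes T: "attractor M (digits ({0..n} \<union> {n + 1 + s})) T"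
    and p: "\<bar>p\<bar> \<ge> 2" and q: "\<bar>q\<bar> \<ge> 2" and s: "s \<ge> 1"
    and \<beta>: "linear \<beta>" "\<beta> v = 0" "\<beta> (A v) = 1"
    and con: "connected T"
  shows "s = 1 \<and> (p * q = 4 \<and> \<bar>p + q\<bar> = 4 \<or> p * q = 12 \<and> \<bar>p + q\<bar> = 7)"
proof -
  define E where "E = {0..n} \<union> {n + 1 + s}"
  define l where "l = n + 1 + s"
  have n: "n \<ge> 2" using mult_mono[of 2 "\<bar>p\<bar>" 2 "\<bar>q\<bar>"] p q by (simp add: n_def abs_mult)
  have T: "attractor M (digits E) T" using T by (simp add: E_def)
  have "v \<noteq> 0" using \<beta> linear_0[OF linA] linear_0[OF \<beta>(1)] by auto
  then have "of_int l *\<^sub>R v \<noteq> 0" using n s by (simp add: l_def)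
  moreover have "0 \<in> digits E" using n by (auto simp: digits_def E_def image_iff intro!: bexI[of _ 0])
  ultimately have "digits E \<noteq> {of_int l *\<^sub>R v}" by auto
  moreover have "finite (digits E)" "of_int l *\<^sub>R v \<in> digits E"
    by (auto simp: digits_def E_def l_def)
  ultimately obtain d where d: "d \<in> digits E" "d \<noteq> of_int l *\<^sub>R v" "of_int l *\<^sub>R v - d \<in> difference_set T"
    using attractor_disconnected[OF T] con by blast
  then obtain k where k: "k \<in> {0..n}" "d = of_int k *\<^sub>R v"
    by (auto simp: digits_def E_def l_def)
  define m where "m = l - k"
  have m: "m \<ge> s + 1" using k(1) by (simp add: m_def l_def)
  have "of_int m *\<^sub>R v \<in> difference_set T"
    using d(3) k(2) by (simp add: m_def scaleR_left_diff_distrib)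
  moreover have "attractor M (digits (difference_set E)) (difference_set T)"
    using attractor_difference_set[OF T] by (simp add: difference_set_digits)
  moreover have "\<bar>k\<bar> \<le> l" if "k \<in> difference_set E" for k
    using that n s by (auto simp: difference_set_def E_def l_def)
  ultimately have "\<bar>m\<bar> * ((\<bar>p\<bar> - 1) * (\<bar>q\<bar> - 1)) \<le> l"
    "(\<bar>p + q\<bar> * \<bar>m\<bar> - l) * ((\<bar>p\<bar> - 1) * (\<bar>q\<bar> - 1)) \<le> l"
    "\<bar>m\<bar> * (\<bar>p * q\<bar> - 1 - \<bar>p + q\<bar>) \<le> l"
    using multiple_bounds[OF _ _ \<beta> _ p q] by blast+
  moreover have "\<bar>m\<bar> = m" using m s by simp
  moreover have "l = \<bar>p * q\<bar> - 1 + s" by (simp add: l_def n_def)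
  ultimately show ?thesis
    using multiple_bounds_exceptional[OF p q s m] by metis
qed

lemma connected_if_s_0_or_exceptional:
  fixes s :: int
  defines "n \<equiv> \<bar>p * q\<bar> - 2"
  assumes T: "attractor M (digits ({0..n} \<union> {n + 1 + s})) T"
    and p: "\<bar>p\<bar> \<ge> 2" and q: "\<bar>q\<bar> \<ge> 2"
    and s: "s = 0 \<or> s = 1 \<and> (p * q = 4 \<and> \<bar>p + q\<bar> = 4 \<or> p * q = 12 \<and> \<bar>p + q\<bar> = 7)"
  shows "connected T"
proof -
  define E where "E = {0..n} \<union> {n + 1 + s}"
  have n: "n \<ge> 2" using mult_mono[of 2 "\<bar>p\<bar>" 2 "\<bar>q\<bar>"] p q by (simp add: n_def abs_mult)
  have T': "attractor M (digits E) T" using T by (simp add: E_def)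
  \<comment> \<open>For \<open>s = 1\<close> the digit \<open>n + 1\<close> is missing, but it is
    the difference of \<open>n + 2\<close> and 1.\<close>
  have nonneg: "k \<in> difference_set E" if k: "0 \<le> k" "k \<le> n + 1 + s" for k
  proof -
    consider "k \<le> n" | "s = 1" "k = n + 1" | "k = n + 1 + s"
      using k s by linarith
    then show ?thesis
    proof cases
      case 1
      then have "k \<in> E" "0 \<in> E" "k = k - 0" using k n by (auto simp: E_def)
      then show ?thesis unfolding difference_set_def by blast
    next
      case 2
      then have "n + 2 \<in> E" "1 \<in> E" "k = (n + 2) - 1" using n by (auto simp: E_def)
      then show ?thesis unfolding difference_set_def by blast
    next
      case 3
      then have "k \<in> E" "0 \<in> E" "k = k - 0" using n by (auto simp: E_def)
      then show ?thesis unfolding difference_set_def by blast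
    qed
  qed
  have E: "k \<in> difference_set E" if "\<bar>k\<bar> \<le> n + 1 + s" for k
    using nonneg[of k] nonneg[of "- k"] difference_set_minus[of "- k" E] that by fastforce
  obtain e :: int where e: "e = 1 \<or> e = -1"
    and 1: "\<bar>p + q - e\<bar> \<le> n + 1" "\<bar>(p - e) * (q - e)\<bar> \<le> n + 1"
    using small_digits[OF p q] by (auto simp: n_def)
  have v: "v \<in> difference_set T"
    using difference_set_const_digits[OF T' e, of 1] E 1 s by auto
  show ?thesis
  proof (rule connected_if_unit_step[OF T _ v])
    \<comment> \<open>The gap below the last digit is \<open>v\<close> for \<open>s = 0\<close> and
      \<open>2 v\<close> for \<open>s = 1\<close>.\<close>
    show "of_int (n + 1 + s - n) *\<^sub>R v \<in> difference_set T"
    proof (cases "s = 0")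
      case True
      then show ?thesis using v by simp
    next
      case False
      with s consider "s = 1" "p * q = 4" "\<bar>p + q\<bar> = 4" | "s = 1" "p * q = 12" "\<bar>p + q\<bar> = 7" by blast
      then show ?thesis
      proof cases
        case 1
        define e :: int where "e = (if p + q = 4 then 1 else - 1)"
        have "e = 1 \<or> e = -1" "p + q = 4 * e" using 1(3) by (auto simp: e_def)
        then have "2 *\<^sub>R v \<in> difference_set T"
          using difference_set_double_root[OF T' _ _ 1(2)] E[of 4] 1 by (simp add: n_def)
        then show ?thesis using 1 by simp
      next
        case 2
        define e :: int where "e = (if p + q = 7 then 1 else - 1)"
        have e: "e = 1 \<or> e = -1" "p + q = 7 * e" using 2(3) by (auto simp: e_def)
        have "(p - e) * (q - e) = p * q - e * (p + q) + e * e" by (simp add: algebra_simps)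
        also have "\<dots> = 6" using e(1) unfolding e(2) 2(2) by auto
        finally have "(p - e) * (q - e) = 6" .
        moreover have "p + q - e = 6 * e" using e by simp
        ultimately have "of_int 2 *\<^sub>R v \<in> difference_set T"
          \<comment> \<open>With \<open>m = 2\<close> the digits are 12 up to sign, exactly the
            largest difference \<open>n + 1 + s\<close>.\<close>
          using difference_set_const_digits[OF T' e(1), of 2] E[of 12] E[of "- 12"] e(1) 2 by (auto simp: n_def)
        then show ?thesis using 2 by simp
      qed
    qed
  qed (use n in simp)
qed

end

section \<open>The planar case\<close>

lemma charpoly_2:
  fixes A :: "'a::comm_ring_1 ^ 2 ^ 2"
  shows "charpoly A = [:A $ 1 $ 1 * A $ 2 $ 2 - A $ 1 $ 2 * A $ 2 $ 1, - (A $ 1 $ 1 + A $ 2 $ 2), 1:]"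
  unfolding charpoly_def map_matrix_def det_2 by (simp add: mat_def algebra_simps)

lemma self_affine_set_eqI:
  assumes "attractor ((*v) (matrix_inv (real_matrix A))) D T"
    and "\<And>T'. attractor ((*v) (matrix_inv (real_matrix A))) D T' \<Longrightarrow> T' = T"
  shows "self_affine_set A D = T"
  using assms unfolding self_affine_set_def attractor_def by (intro the_equality) blast+

theorem theorem1p3:
  fixes p q s :: int
    and A :: "int ^ 2 ^ 2"
    and f :: "int poly"
    and v :: "real ^ 2"
    and D :: "(real ^ 2) set"
  assumes "\<bar>p\<bar> \<ge> 2" and "\<bar>q\<bar> \<ge> 2" and "s \<ge> 0"
    and "f = [:p * q, - (p + q), 1:]"
    and "charpoly A = f"
    and "independent {v, real_matrix A *v v}"
    and "D = digit_set p q s v"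
  shows "(f \<notin> {[:4, 4, 1:], [:4, -4, 1:], [:12, 7, 1:], [:12, -7, 1:]} \<longrightarrow>
            (connected (self_affine_set A D) \<longleftrightarrow> s = 0)) \<and>
         (f \<in> {[:4, 4, 1:], [:4, -4, 1:], [:12, 7, 1:], [:12, -7, 1:]} \<longrightarrow>
            (connected (self_affine_set A D) \<longleftrightarrow> s = 0 \<or> s = 1))"
proof -
  note p = assms(1) and q = assms(2)
  define R where "R = real_matrix A"
  define M where "M = matrix_inv R"
  have coeffs: "A $ 1 $ 1 * A $ 2 $ 2 - A $ 1 $ 2 * A $ 2 $ 1 = p * q" "A $ 1 $ 1 + A $ 2 $ 2 = p + q"
    using assms(4,5) by (simp_all add: charpoly_2)
  have R: "R $ i $ j = of_int (A $ i $ j)" for i j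
    by (simp add: R_def real_matrix_def map_matrix_def)
  have "det R = of_int (p * q)" unfolding det_2 R coeffs(1)[symmetric] by simp
  then have "invertible R" using p q by (auto simp: invertible_det_nz)
  then have "R ** M = mat 1 \<and> M ** R = mat 1"
    unfolding M_def matrix_inv_def invertible_def by (rule someI_ex)
  then have RM: "R *v (M *v x) = x" and MR: "M *v (R *v x) = x" for x
    by (simp_all add: matrix_vector_mul_assoc)
  have quad: "R *v (R *v x) = of_int (p + q) *\<^sub>R (R *v x) - of_int (p * q) *\<^sub>R x" for x
    unfolding coeffs[symmetric]
    by (simp add: vec_eq_iff forall_2 matrix_vector_mult_def sum_2 R algebra_simps)
  define N where "N x = norm x + 4 * norm (M *v x - (1 / of_int p) *\<^sub>R x)" for x
  have "expanding_map ((*v) R) ((*v) M) N (3 / 4)"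
    unfolding N_def using p q RM MR quad
    by (intro expanding_map_quadratic[where q = "of_int q"]) auto
  then interpret quadratic_map "(*v) R" "(*v) M" N "3 / 4" p q v
    using quad by (auto simp: quadratic_map_def quadratic_map_axioms_def)
  have indep: "independent {v, R *v v}" using assms(6) by (simp add: R_def)
  \<comment> \<open>If the two vectors coincided, the set \<open>{v, R *v v}\<close> would be a
    singleton and could still be independent; this is excluded because 1 is not an
    eigenvalue.\<close>
  have "R *v v \<noteq> v"
  proof
    assume "R *v v = v"
    then have "v = of_int (p + q) *\<^sub>R v - of_int (p * q) *\<^sub>R v" using quad[of v] by simp
    then have "of_int ((p - 1) * (q - 1)) *\<^sub>R v = 0" by (simp add: algebra_simps)
    then have "v = 0" using p q by auto
    then show False using indep dependent_zero[of "{v, R *v v}"] by simp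
  qed
  then obtain \<beta> :: "real ^ 2 \<Rightarrow> real" where \<beta>: "linear \<beta>" "\<beta> v = 0" "\<beta> (R *v v) = 1"
    using linear_independent_extend[OF indep, of "\<lambda>x. if x = v then 0 else 1"] by auto
  define n where "n = \<bar>p * q\<bar> - 2"
  have D: "D = digits ({0..n} \<union> {n + 1 + s})"
    using assms(7) by (simp add: digit_set_def digits_def n_def algebra_simps)
  obtain T where T: "attractor ((*v) M) D T"
    using attractor_exists[of D] unfolding D digits_def by auto
  have self: "self_affine_set A D = T"
    using T attractor_unique by (intro self_affine_set_eqI) (auto simp: M_def R_def)
  have "connected T \<longleftrightarrow> s = 0 \<or> s = 1 \<and> (p * q = 4 \<and> \<bar>p + q\<bar> = 4 \<or> p * q = 12 \<and> \<bar>p + q\<bar> = 7)"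
    using connected_if_s_0_or_exceptional[of s T] connected_imp_exceptional[of s T, OF _ p q _ \<beta>]
      T p q \<open>s \<ge> 0\<close> unfolding D n_def by fastforce
  moreover have "f \<in> {[:4, 4, 1:], [:4, -4, 1:], [:12, 7, 1:], [:12, -7, 1:]} \<longleftrightarrow>
      p * q = 4 \<and> \<bar>p + q\<bar> = 4 \<or> p * q = 12 \<and> \<bar>p + q\<bar> = 7"
    unfolding assms(4) by auto
  ultimately show ?thesis unfolding self by blast
qed

end
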